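(* Let $P_s$ be the path with vertices $v_1,\dots,v_s$ and define $h(v_i)=4s-2$ for $1\le i<s$ and $h(v_s)=2s-1$. Then the game $\langle P_s, h, g\rangle$, where $g$ is the function constantly equal to $s$, is winning.
   Context: Hat guessing game $\langle G, h, g\rangle$: a sage sits at each vertex $v$ of the graph $G$; an adversary puts on the head of each sage $v$ a hat whose color is chosen from $\{0,1,\dots,h(v)-1\}$; each sage sees the hat colors of his neighbours but not his own; without communication, each sage $v$ names a list of $g(v)$ colors, determined by a deterministic strategy (fixed in advance and known to the adversary) from the colors he sees. The game is winning if there is a strategy guaranteeing that for every hat assignment at least one sage's list contains his own hat color. Here $s\ge 1$ is an integer. *)

theory Defs
  imports "HOL-Library.FuncSet" "Graph_Theory.Pair_Digraph"
begin

text \<open>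
  Undirected graphs are the symmetric loop-free digraphs of the library
  (locale \<^locale>\<open>pair_graph\<close>): an edge \<open>uv\<close> is represented by the two arcs \<open>(u, v)\<close> and \<open>(v, u)\<close>.
\<close>

definition neighbours :: "'a pair_pre_digraph \<Rightarrow> 'a \<Rightarrow> 'a set" where
  "neighbours G v = {u. (v, u) \<in> parcs G}"

definition hat_assignments :: "'a set \<Rightarrow> ('a \<Rightarrow> nat) \<Rightarrow> ('a \<Rightarrow> nat) set" where
  "hat_assignments U h = (\<Pi>\<^sub>E u\<in>U. {0..<h u})"

text \<open>
  A strategy maps a vertex \<open>v\<close> and an assignment of hats to the neighbours of \<open>v\<close> (all that the
  sage at \<open>v\<close> sees) to the list of guesses. The list is unordered and without repetitions, hence
  a set of exactly \<open>g v\<close> of the \<open>h v\<close> admissible colours; this presupposes \<open>g v \<le> h v\<close>.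
\<close>

definition is_strategy ::
    "'a pair_pre_digraph \<Rightarrow> ('a \<Rightarrow> nat) \<Rightarrow> ('a \<Rightarrow> nat) \<Rightarrow> ('a \<Rightarrow> ('a \<Rightarrow> nat) \<Rightarrow> nat set) \<Rightarrow> bool" where
  "is_strategy G h g \<sigma> \<longleftrightarrow>
     (\<forall>v\<in>pverts G. \<forall>x\<in>hat_assignments (neighbours G v) h.
        \<sigma> v x \<subseteq> {0..<h v} \<and> card (\<sigma> v x) = g v)"

definition winning_game :: "'a pair_pre_digraph \<Rightarrow> ('a \<Rightarrow> nat) \<Rightarrow> ('a \<Rightarrow> nat) \<Rightarrow> bool" where
  "winning_game G h g \<longleftrightarrow>
     (\<exists>\<sigma>. is_strategy G h g \<sigma> \<and>
        (\<forall>c\<in>hat_assignments (pverts G) h.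
           \<exists>v\<in>pverts G. c v \<in> \<sigma> v (restrict c (neighbours G v))))"

definition path_graph :: "nat \<Rightarrow> nat pair_pre_digraph" where
  "path_graph n = \<lparr> pverts = {1..n},
     parcs = {(i, j). i \<in> {1..n} \<and> j \<in> {1..n} \<and> (j = i + 1 \<or> i = j + 1)} \<rparr>"

lemma pair_graph_path_graph: "pair_graph (path_graph n)"
proof
  show "finite (parcs (path_graph n))"
    by (rule finite_subset[of _ "{1..n} \<times> {1..n}"]) (auto simp: path_graph_def)
  show "symmetric (with_proj (path_graph n))"
    by (auto simp: symmetric_def path_graph_def sym_def arcs_ends_def arc_to_ends_def with_proj_def)
qed (auto simp: path_graph_def)

end

theory Submission
  imports Defs
begin

text \<open>
  Put \<open>H = 4s - 2\<close>, \<open>d\<^sub>i = s + i - 1\<close>, and say that colours \<open>a\<close> of \<open>v\<^sub>i\<close> and \<open>b\<close> of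
  \<open>v\<^sub>i\<^sub>+\<^sub>1\<close> are linked if \<open>(a d\<^sub>i + b) mod H \<ge> H - d\<^sub>i\<close>, where \<open>b\<close> is doubled when
  \<open>i + 1 = s\<close>. For fixed \<open>a\<close> the linked \<open>b\<close> form a cyclic interval of length \<open>d\<^sub>i\<close>; for fixed \<open>b\<close>
  the linked \<open>a\<close> form an evenly spread set of size \<open>d\<^sub>i\<close>, which meets every cyclic interval of
  length \<open>d\<^sub>i\<^sub>-\<^sub>1\<close> in at least \<open>\<lfloor>d\<^sub>i d\<^sub>i\<^sub>-\<^sub>1 / H\<rfloor> \<ge> i - 1\<close> colours. The sage at \<open>v\<^sub>i\<close> names the
  colours linked to the one he sees on \<open>v\<^sub>i\<^sub>+\<^sub>1\<close> but not to the one he sees on \<open>v\<^sub>i\<^sub>-\<^sub>1\<close>; there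
  are at most \<open>d\<^sub>i - (i - 1) = s\<close> of these. If all of \<open>v\<^sub>1, \<dots>, v\<^sub>s\<^sub>-\<^sub>1\<close> are wrong, then inductively
  no two consecutive colours are linked, so the last sage, who names all colours not linked to that
  of \<open>v\<^sub>s\<^sub>-\<^sub>1\<close>, is right.
\<close>

definition linked :: "nat \<Rightarrow> nat \<Rightarrow> nat \<Rightarrow> nat \<Rightarrow> bool" where
  "linked H d a b \<longleftrightarrow> (a * d + b) mod H \<ge> H - d"

lemma div_add_if:
  fixes n d H :: nat
  assumes "d \<le> H" "H > 0"
  shows "(n + d) div H = n div H + (if n mod H \<ge> H - d then 1 else 0)"
proof -
  have *: "(n + d) div H = n div H + (n mod H + d) div H"
    using div_mult_self3[of H "n div H" "n mod H + d"] assms(2)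
    by (simp add: add.assoc[symmetric])
  show ?thesis
  proof (cases "n mod H \<ge> H - d")
    case True
    have "n mod H < H" using assms by simp
    then have "H \<le> n mod H + d" "n mod H + d < 2 * H"
      using True assms(1) by linarith+
    then have "(n mod H + d) div H = 1" by (intro div_nat_eqI) simp_all
    then show ?thesis using * True by simp
  next
    case False
    then have "(n mod H + d) div H = 0" using assms by simp
    then show ?thesis using * False by simp
  qed
qed

text \<open>By \<open>div_add_if\<close>, the quotient \<open>(n * d + c) div H\<close> grows by one
  from \<open>n\<close> to \<open>n + 1\<close> if \<open>n\<close> is linked to \<open>c\<close>
  and stays constant otherwise, so the count telescopes.\<close>

lemma card_linked_window:
  assumes "d \<le> H" "H > 0"
  shows "card {n \<in> {x..<x + L}. linked H d n c} = ((x + L) * d + c) div H - (x * d + c) div H"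
proof (induction L)
  case (Suc L)
  let ?q = "\<lambda>n. (n * d + c) div H"
  have step: "?q (Suc (x + L)) = ?q (x + L) + (if linked H d (x + L) c then 1 else 0)"
    using div_add_if[OF assms, of "(x + L) * d + c"]
    by (simp add: linked_def algebra_simps)
  have le: "?q x \<le> ?q (x + L)" by (intro div_le_mono) simp
  have "{n \<in> {x..<x + Suc L}. linked H d n c} =
      (if linked H d (x + L) c then insert (x + L) {n \<in> {x..<x + L}. linked H d n c}
       else {n \<in> {x..<x + L}. linked H d n c})"
    by (auto simp: less_Suc_eq)
  then have "card {n \<in> {x..<x + Suc L}. linked H d n c} =
      card {n \<in> {x..<x + L}. linked H d n c} + (if linked H d (x + L) c then 1 else 0)"
    by (simp del: add_Suc_right)
  also have "\<dots> = ?q (x + Suc L) - ?q x"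
    unfolding Suc.IH add_Suc_right step using le by linarith
  finally show ?case .
qed simp

lemma card_linked_left:
  assumes "d \<le> H" "H > 0"
  shows "card {a. a < H \<and> linked H d a c} = d"
proof -
  have "{a. a < H \<and> linked H d a c} = {n \<in> {0..<0 + H}. linked H d n c}" by auto
  moreover have "(H * d + c) div H = d + c div H" using assms(2) by simp
  ultimately show ?thesis using card_linked_window[OF assms, of 0 H c] by simp
qed

lemma card_linked_window_ge:
  assumes "d \<le> H" "H > 0"
  shows "card {n \<in> {x..<x + L}. linked H d n c} \<ge> L * d div H"
proof -
  have "L * d div H + (x * d + c) div H \<le> (L * d + (x * d + c)) div H"
    using div_add1_eq[of "L * d" "x * d + c" H] by linarith
  then show ?thesis
    unfolding card_linked_window[OF assms] by (simp add: algebra_simps)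
qed

lemma linked_mod_left: "linked H d (n mod H) c \<longleftrightarrow> linked H d n c"
  unfolding linked_def by (metis mod_add_left_eq mod_mult_left_eq)

lemma inj_on_mod_window: "inj_on (\<lambda>n::nat. n mod H) {x..<x + H}"
proof (rule linorder_inj_onI)
  fix m n assume "m < n" "m \<in> {x..<x + H}" "n \<in> {x..<x + H}"
  then have "0 < n - m" "n - m < H" by auto
  then have "\<not> H dvd n - m" by (rule nat_dvd_not_less)
  then show "m mod H \<noteq> n mod H"
    using \<open>m < n\<close> mod_eq_dvd_iff_nat[of m n H] by auto
qed auto

text \<open>The residues of suitable \<open>d'\<close> consecutive integers are all linked to
  \<open>a\<close>, and being linked to \<open>c\<close> depends only on the residue mod
  \<open>H\<close>, so the window bound applies.\<close>

lemma card_linked_both_ge: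
  assumes "d \<le> H" "d' \<le> H" "H > 0"
  shows "card {b. b < H \<and> linked H d b c \<and> linked H d' a b} \<ge> d' * d div H"
proof -
  \<comment> \<open>Modulo \<open>H\<close> this is \<open>- a * d' - d'\<close>, so
    \<open>a * d' + x\<close> is congruent to \<open>H - d'\<close>, where the linked residues
    begin.\<close>
  define x where "x = a * (H - d') + (H - d')"
  let ?W = "{n \<in> {x..<x + d'}. linked H d n c}"
  have "linked H d' a (n mod H)" if "n \<in> {x..<x + d'}" for n
  proof -
    from that obtain j where j: "n = x + j" "j < d'"
      by (auto simp: le_iff_add)
    have "a * d' + n = a * (d' + (H - d')) + (H - d' + j)"
      unfolding j x_def by (simp only: distrib_left add.assoc)
    then have "a * d' + n = a * H + (H - d' + j)"
      using assms by simp
    moreover have "H - d' + j < H" using j(2) assms by simp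
    ultimately have "(a * d' + n) mod H = H - d' + j"
      by (metis mod_less mod_mult_self3)
    then show ?thesis unfolding linked_def by (simp add: mod_add_right_eq)
  qed
  then have sub: "(\<lambda>n. n mod H) ` ?W \<subseteq> {b. b < H \<and> linked H d b c \<and> linked H d' a b}"
    using assms(3) by (auto simp: linked_mod_left)
  have "inj_on (\<lambda>n. n mod H) ?W"
    using inj_on_mod_window by (rule inj_on_subset) (use assms in auto)
  then have "card ?W \<le> card {b. b < H \<and> linked H d b c \<and> linked H d' a b}"
    using sub by (rule card_inj_on_le) simp
  then show ?thesis
    using card_linked_window_ge[OF assms(1,3), of d' x c] by linarith
qed

text \<open>Everything is even: halving turns the condition into
  \<open>(a * (s - 1) + b) mod (2 * s - 1) < s\<close>, and distinct \<open>b\<close> give distinct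
  residues.\<close>

lemma card_not_linked_double_le:
  assumes "s \<ge> 1"
  shows "card {b. b < 2 * s - 1 \<and> \<not> linked (4 * s - 2) (2 * s - 2) a (2 * b)} \<le> s"
proof -
  define N where "N = 2 * s - 1"
  let ?y = "a * (s - 1)"
  let ?B = "{b. b < N \<and> \<not> linked (4 * s - 2) (2 * s - 2) a (2 * b)}"
  have "(?y + b) mod N < s" if "\<not> linked (4 * s - 2) (2 * s - 2) a (2 * b)" for b
  proof -
    have "a * (2 * s - 2) + 2 * b = 2 * (?y + b)" "4 * s - 2 = 2 * N"
      by (simp_all add: N_def algebra_simps)
    then have "(a * (2 * s - 2) + 2 * b) mod (4 * s - 2) = 2 * ((?y + b) mod N)"
      by (metis mult_mod_right)
    then show ?thesis using that assms unfolding linked_def by linarith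
  qed
  then have sub: "(\<lambda>b. (?y + b) mod N) ` ?B \<subseteq> {..<s}" by auto
  have "inj_on ((\<lambda>n. n mod N) \<circ> (+) ?y) ?B"
    by (intro comp_inj_on inj_on_subset[OF inj_on_mod_window[of N ?y]]) auto
  then have "inj_on (\<lambda>b. (?y + b) mod N) ?B" by (simp add: comp_def)
  then have "card ?B \<le> card {..<s}" using sub by (rule card_inj_on_le) simp
  then show ?thesis by (simp add: N_def)
qed

text \<open>Shorter lists suffice: since \<open>g v \<le> h v\<close>, they can be padded with
  arbitrary colours to size \<open>g v\<close>.\<close>

lemma winning_gameI:
  assumes g: "\<And>v. v \<in> pverts G \<Longrightarrow> g v \<le> h v"
    and sub: "\<And>v x. v \<in> pverts G \<Longrightarrow> B v x \<subseteq> {0..<h v}"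
    and card: "\<And>v x. v \<in> pverts G \<Longrightarrow> card (B v x) \<le> g v"
    and win: "\<And>c. c \<in> hat_assignments (pverts G) h \<Longrightarrow>
      \<exists>v\<in>pverts G. c v \<in> B v (restrict c (neighbours G v))"
  shows "winning_game G h g"
proof -
  have "\<exists>A. v \<in> pverts G \<longrightarrow> B v x \<subseteq> A \<and> A \<subseteq> {0..<h v} \<and> card A = g v" for v x
    using exists_subset_between[of "B v x" "g v" "{0..<h v}"] g sub card
    by (metis card_atLeastLessThan diff_zero finite_atLeastLessThan)
  then obtain \<sigma> where
    "\<And>v x. v \<in> pverts G \<Longrightarrow> B v x \<subseteq> \<sigma> v x \<and> \<sigma> v x \<subseteq> {0..<h v} \<and> card (\<sigma> v x) = g v"
    by metis
  then show ?thesis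
    using win unfolding winning_game_def is_strategy_def by (intro exI[of _ \<sigma>]) blast
qed

theorem theorem3p1:
  fixes s :: nat and h :: "nat \<Rightarrow> nat"
  assumes "s \<ge> 1"
    and "\<And>i. 1 \<le> i \<Longrightarrow> i < s \<Longrightarrow> h i = 4 * s - 2"
    and "h s = 2 * s - 1"
  shows "winning_game (path_graph s) h (\<lambda>_. s)"
proof -
  define H where "H = 4 * s - 2"
  \<comment> \<open>Doubling places the \<open>2 * s - 1\<close> colours of the last hat at the even
    residues mod \<open>H\<close>.\<close>
  define e where "e v y = (if v = s then 2 * y else y)" for v y :: nat
  define R where "R v a b \<longleftrightarrow> linked H (s + v - 1) a (e (Suc v) b)" for v a b
  define B where "B v x = {b. b < h v \<and> (v < s \<longrightarrow> R v b (x (Suc v))) \<and>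
    (v > 1 \<longrightarrow> \<not> R (v - 1) (x (v - 1)) b)}" for v and x :: "nat \<Rightarrow> nat"
  have H0: "H > 0" using assms(1) by (simp add: H_def)
  have card: "card (B v x) \<le> s" if v: "1 \<le> v" "v \<le> s" for v x
  proof (cases "v = s")
    case True
    show ?thesis
    proof (cases "s = 1")
      case True
      \<comment> \<open>A lone sage sees nobody, but his hat has only one possible colour.\<close>
      then have "B v x \<subseteq> {..<1}" using \<open>v = s\<close> assms(3) by (auto simp: B_def)
      then have "card (B v x) \<le> card {..<1::nat}" by (intro card_mono) auto
      then show ?thesis using True by simp
    next
      case False
      have "B v x = {b. b < 2 * s - 1 \<and>
          \<not> linked (4 * s - 2) (2 * s - 2) (x (v - 1)) (2 * b)}"
        using True False assms(1,3) by (auto simp: B_def R_def e_def H_def mult_2 numeral_2_eq_2)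
      then show ?thesis using card_not_linked_double_le[OF assms(1)] by simp
    qed
  next
    case False
    then have vs: "v < s" and hv: "h v = H" using v assms(2) by (auto simp: H_def)
    let ?d = "s + v - 1" and ?c = "e (Suc v) (x (Suc v))"
    let ?D = "{b. b < H \<and> linked H ?d b ?c}"
    have d: "?d \<le> H" using vs by (simp add: H_def)
    have cD: "card ?D = ?d" by (rule card_linked_left[OF d H0])
    show ?thesis
    proof (cases "v = 1")
      case True
      then have "B v x = ?D" using vs hv by (auto simp: B_def R_def)
      then show ?thesis using cD True by simp
    next
      case False
      define j where "j = v - 2"
      define t where "t = s - v"
      have jt: "v = j + 2" "s = j + 2 + t" using False v by (auto simp: j_def t_def)
      let ?d' = "s + (v - 1) - 1" and ?a = "x (v - 1)"
      let ?E = "{b. b < H \<and> linked H ?d b ?c \<and> linked H ?d' ?a b}"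
      \<comment> \<open>The right side exceeds the left by exactly
        \<open>t * (t + 1)\<close>.\<close>
      have "(v - 1) * H \<le> ?d' * ?d"
        unfolding H_def jt by (simp add: algebra_simps)
      then have "v - 1 \<le> ?d' * ?d div H" using H0 by (simp add: less_eq_div_iff_mult_less_eq)
      also have "\<dots> \<le> card ?E"
        using d H0 by (intro card_linked_both_ge) auto
      finally have cE: "v - 1 \<le> card ?E" .
      have "B v x = ?D - ?E"
        using vs hv v False by (auto simp: B_def R_def e_def)
      moreover have "card (?D - ?E) = card ?D - card ?E"
        by (rule card_Diff_subset) auto
      ultimately have "card (B v x) = ?d - card ?E" using cD by simp
      then show ?thesis using cE v(1) by linarith
    qed
  qed
  have nb: "neighbours (path_graph s) v = {u. u \<in> {1..s} \<and> (u = Suc v \<or> v = Suc u)}"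
    if "v \<in> {1..s}" for v
    using that by (auto simp: neighbours_def path_graph_def)
  have pv: "pverts (path_graph s) = {1..s}" by (simp add: path_graph_def)
  show ?thesis
  proof (rule winning_gameI[where B = B], unfold pv)
    fix v assume v: "v \<in> {1..s}"
    then show "s \<le> h v" using assms by (cases "v = s") auto
    fix x
    show "B v x \<subseteq> {0..<h v}" by (auto simp: B_def)
    show "card (B v x) \<le> s" using v by (intro card) auto
  next
    fix c assume c: "c \<in> hat_assignments {1..s} h"
    show "\<exists>v\<in>{1..s}. c v \<in> B v (restrict c (neighbours (path_graph s) v))"
    proof (rule ccontr)
      assume "\<not> ?thesis"
      then have wrong: "c v \<notin> B v (restrict c (neighbours (path_graph s) v))"
        if "1 \<le> v" "v \<le> s" for v using that by auto
      have ch: "c v < h v" if "1 \<le> v" "v \<le> s" for v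
        using c that by (auto simp: hat_assignments_def PiE_iff)
      \<comment> \<open>The conjunct \<open>v < s\<close> records that the last sage cannot be wrong
        here; at \<open>v = s\<close> it becomes the final contradiction.\<close>
      have not_linked: "v < s \<and> \<not> R v (c v) (c (Suc v))"
        if v: "1 \<le> v" "v \<le> s" and prev: "v > 1 \<Longrightarrow> \<not> R (v - 1) (c (v - 1)) (c v)" for v
      proof -
        let ?x = "restrict c (neighbours (path_graph s) v)"
        have "v < s \<Longrightarrow> ?x (Suc v) = c (Suc v)" "v > 1 \<Longrightarrow> ?x (v - 1) = c (v - 1)"
          using v by (auto simp: nb)
        then show ?thesis
          using wrong[OF v] ch[OF v] v prev unfolding B_def by auto
      qed
      have "v < s \<and> \<not> R v (c v) (c (Suc v))" if "1 \<le> v" "v \<le> s" for v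
        using that
      proof (induction v rule: dec_induct)
        case base
        then show ?case using not_linked[of 1] by simp
      next
        case (step n)
        then show ?case using not_linked[of "Suc n"] by simp
      qed
      from this[of s] show False using assms(1) by simp
    qed
  qed
qed

end
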